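(* Let $(X,\mathcal{D})$ be a reflexive diffeological space whose D-topology is $T_0$. Then the D-topology of $(X,\mathcal{D})$ is Hausdorff.
   Context: A parametrisation of a nonempty set $X$ is a function $p\colon U\to X$ where $U$ is an open subset of $\mathbb{R}^n$ for some $n$. A diffeology $\mathcal{D}$ on $X$ is a set of parametrisations of $X$ (called plots) such that: (1) (Covering) for every $x\in X$ and every nonnegative integer $n$, the constant function $\mathbb{R}^n\to\{x\}\subseteq X$ is in $\mathcal{D}$; (2) (Locality) if $p\colon U\to X$ is a parametrisation such that every $u\in U$ has an open neighbourhood $V$ in $U$ with $p|_V\in\mathcal{D}$, then $p\in\mathcal{D}$; (3) (Smooth compatibility) if $p\colon U\to X$ is in $\mathcal{D}$, $V\subseteq\mathbb{R}^n$ is open (any $n$), and $F\colon V\to U$ is infinitely differentiable, then $p\circ F\in\mathcal{D}$. A diffeological space is a nonempty set with a diffeology. Its D-topology is the strongest topology on $X$ in which every plot is continuous: $Y\subseteq X$ is D-open iff $p^{-1}(Y)$ is open in the domain of $p$ for every $p\in\mathcal{D}$. For a set $\mathcal{D}_0$ of parametrisations of $X$, $\Phi\mathcal{D}_0:=\{f\colon X\to\mathbb{R} \mid f\circ p\in C^\infty(U)\text{ for all }(p\colon U\to X)\in\mathcal{D}_0\}$. For a set $\mathcal{F}_0$ of real-valued functions on $X$, $\Pi\mathcal{F}_0:=\{\text{parametrisations }p\colon U\to X \mid f\circ p\in C^\infty(U)\text{ for all }f\in\mathcal{F}_0\}$. A diffeology $\mathcal{D}$ is reflexive if $\Pi\Phi\mathcal{D}=\mathcal{D}$.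 *)

theory Defs
  imports "HOL-Analysis.Analysis"
begin

text \<open>
  The dimension of the domain of a plot varies within a single diffeology, so \<open>\<real>\<^sup>n\<close> is
  \<^term>\<open>Euclidean_space n\<close>: the functions \<open>nat \<Rightarrow> real\<close> vanishing at all indices \<open>\<ge> n\<close>.
\<close>

section \<open>Smooth maps between open subsets of Euclidean spaces\<close>

text \<open>
  \<open>Ck_on k n U f\<close>: all partial derivatives of \<open>f\<close> of order \<open>\<le> k\<close> exist and are continuous on the
  open set \<open>U \<subseteq> \<real>\<^sup>n\<close>. Since \<open>U\<close> is open, \<open>x(i := t)\<close> lies in \<open>U\<close> for \<open>i < n\<close> and \<open>t\<close> near \<open>x i\<close>,
  so the values of \<open>f\<close> and of its partial derivatives \<open>g\<close> outside \<open>U\<close> are irrelevant.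
\<close>

primrec Ck_on ::
  "nat \<Rightarrow> nat \<Rightarrow> (nat \<Rightarrow> real) set \<Rightarrow> ((nat \<Rightarrow> real) \<Rightarrow> real) \<Rightarrow> bool"
where
  "Ck_on 0 n U f \<longleftrightarrow> continuous_map (subtopology (Euclidean_space n) U) euclideanreal f"
| "Ck_on (Suc k) n U f \<longleftrightarrow>
     continuous_map (subtopology (Euclidean_space n) U) euclideanreal f \<and>
     (\<forall>i<n. \<exists>g. (\<forall>x\<in>U. ((\<lambda>t. f (x(i := t))) has_real_derivative g x) (at (x i))) \<and>
                Ck_on k n U g)"

definition smooth_on ::
  "nat \<Rightarrow> (nat \<Rightarrow> real) set \<Rightarrow> ((nat \<Rightarrow> real) \<Rightarrow> real) \<Rightarrow> bool"
where
  "smooth_on n U f \<longleftrightarrow> (\<forall>k. Ck_on k n U f)"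

definition smooth_map ::
  "nat \<Rightarrow> (nat \<Rightarrow> real) set \<Rightarrow> nat \<Rightarrow> (nat \<Rightarrow> real) set \<Rightarrow> ((nat \<Rightarrow> real) \<Rightarrow> (nat \<Rightarrow> real)) \<Rightarrow> bool"
where
  "smooth_map m V n U F \<longleftrightarrow> F \<in> V \<rightarrow> U \<and> (\<forall>i<n. smooth_on m V (\<lambda>x. F x i))"

section \<open>Diffeological spaces\<close>

text \<open>
  A triple \<open>(n, U, p)\<close> stands for \<open>p: U \<rightarrow> X\<close> with \<open>U\<close> open in \<open>\<real>\<^sup>n\<close>. The map \<open>p\<close> is required to be
  extensional, so that equality of triples is equality of functions with domain \<open>U\<close>; likewise for
  real-valued functions on \<open>X\<close> below.
\<close>

type_synonym 'a parametrisation = "nat \<times> (nat \<Rightarrow> real) set \<times> ((nat \<Rightarrow> real) \<Rightarrow> 'a)"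

definition parametrisations :: "'a set \<Rightarrow> 'a parametrisation set" where
  "parametrisations X = {(n, U, p). openin (Euclidean_space n) U \<and> p \<in> U \<rightarrow>\<^sub>E X}"

locale diffeological_space =
  fixes X :: "'a set" and D :: "'a parametrisation set"
  assumes nonempty: "X \<noteq> {}"
    and plots: "D \<subseteq> parametrisations X"
    and covering:
      "\<And>x n. x \<in> X \<Longrightarrow>
        (n, topspace (Euclidean_space n), \<lambda>u \<in> topspace (Euclidean_space n). x) \<in> D"
    and locality:
      "\<And>n U p. (n, U, p) \<in> parametrisations X \<Longrightarrow>
        (\<And>u. u \<in> U \<Longrightarrow>
          \<exists>V. openin (Euclidean_space n) V \<and> u \<in> V \<and> V \<subseteq> U \<and> (n, V, restrict p V) \<in> D) \<Longrightarrow>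
        (n, U, p) \<in> D"
    and smooth_compatibility:
      "\<And>n U p m V F. (n, U, p) \<in> D \<Longrightarrow> openin (Euclidean_space m) V \<Longrightarrow>
        smooth_map m V n U F \<Longrightarrow> (m, V, compose V p F) \<in> D"

definition D_open :: "'a set \<Rightarrow> 'a parametrisation set \<Rightarrow> 'a set \<Rightarrow> bool" where
  "D_open X D Y \<longleftrightarrow> Y \<subseteq> X \<and>
     (\<forall>(n, U, p) \<in> D. openin (subtopology (Euclidean_space n) U) {u \<in> U. p u \<in> Y})"

definition D_topology :: "'a set \<Rightarrow> 'a parametrisation set \<Rightarrow> 'a topology" where
  "D_topology X D = topology (D_open X D)"

lemma istopology_D_open: "istopology (D_open X D)"
proof -
  have "D_open X D (S \<inter> T)" if "D_open X D S" "D_open X D T" for S T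
  proof -
    have eq: "{u \<in> U. p u \<in> S \<inter> T} = {u \<in> U. p u \<in> S} \<inter> {u \<in> U. p u \<in> T}"
      for U and p :: "(nat \<Rightarrow> real) \<Rightarrow> 'a" by auto
    show ?thesis
      using that unfolding D_open_def eq by (auto intro: openin_Int)
  qed
  moreover have "D_open X D (\<Union>\<K>)" if "\<forall>K\<in>\<K>. D_open X D K" for \<K>
  proof -
    have eq: "{u \<in> U. p u \<in> \<Union>\<K>} = (\<Union>K\<in>\<K>. {u \<in> U. p u \<in> K})"
      for U and p :: "(nat \<Rightarrow> real) \<Rightarrow> 'a" by auto
    show ?thesis
      using that unfolding D_open_def eq by (fastforce intro: openin_Union)
  qed
  ultimately show ?thesis
    by (simp add: istopology_def)
qed

lemma openin_D_topology [simp]: "openin (D_topology X D) Y \<longleftrightarrow> D_open X D Y"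
  by (simp add: D_topology_def topology_inverse' istopology_D_open)

lemma topspace_D_topology:
  assumes "D \<subseteq> parametrisations X"
  shows "topspace (D_topology X D) = X"
proof -
  have "D_open X D X"
    unfolding D_open_def
  proof clarsimp
    fix n U p
    assume "(n, U, p) \<in> D"
    with assms have "openin (Euclidean_space n) U" "p \<in> U \<rightarrow>\<^sub>E X"
      by (auto simp: parametrisations_def)
    moreover from this have "{u \<in> U. p u \<in> X} = U"
      by auto
    ultimately show "openin (subtopology (Euclidean_space n) U) {u \<in> U. p u \<in> X}"
      by (simp add: openin_subtopology_refl openin_subset)
  qed
  then show ?thesis
    unfolding topspace_def by (auto simp: D_open_def)
qed

section \<open>Reflexive diffeologies\<close>

definition Phi :: "'a set \<Rightarrow> 'a parametrisation set \<Rightarrow> ('a \<Rightarrow> real) set" where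
  "Phi X D0 = {f \<in> X \<rightarrow>\<^sub>E UNIV. \<forall>(n, U, p) \<in> D0. smooth_on n U (f \<circ> p)}"

definition Pi_par :: "'a set \<Rightarrow> ('a \<Rightarrow> real) set \<Rightarrow> 'a parametrisation set" where
  "Pi_par X F0 = {(n, U, p) \<in> parametrisations X. \<forall>f \<in> F0. smooth_on n U (f \<circ> p)}"

definition reflexive_diffeology :: "'a set \<Rightarrow> 'a parametrisation set \<Rightarrow> bool" where
  "reflexive_diffeology X D \<longleftrightarrow> Pi_par X (Phi X D) = D"

end

theory Submission
  imports Defs
begin

text \<open>
  Call the smooth functions in \<open>Phi X D\<close> the test functions. They are continuous for the D-topology,
  so it suffices that they separate points. Suppose that they all agree at \<open>x\<close> and \<open>y\<close>. Then every
  map \<open>p: \<real> \<rightarrow> {x, y}\<close>, however wild, becomes constant after composition with a test function, and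
  reflexivity makes it a plot. Take the map that sends \<open>0\<close> to \<open>x\<close> and all other reals to \<open>y\<close>: a D-open
  set that contains \<open>x\<close> but not \<open>y\<close> would pull back to \<open>{0}\<close>, which is not open in \<open>\<real>\<close>.
  Hence \<open>x\<close> and \<open>y\<close> are topologically indistinguishable, and \<open>T\<^sub>0\<close> forces \<open>x = y\<close>.
\<close>

text \<open>
  On a whole Euclidean space the coordinate lines \<open>x(i := t)\<close> never leave the domain, so the
  values of \<open>f\<close> elsewhere cannot affect its partial derivatives. This matters because a composite
  \<open>f \<circ> p\<close> with an extensional \<open>p\<close> is constant on the domain only.
\<close>
lemma smooth_on_constant:
  assumes "\<And>u. u \<in> topspace (Euclidean_space n) \<Longrightarrow> f u = c"
  shows "smooth_on n (topspace (Euclidean_space n)) f"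
proof -
  have cont: "continuous_map (Euclidean_space n) euclideanreal f"
    if "\<And>u. u \<in> topspace (Euclidean_space n) \<Longrightarrow> f u = c" for f c
    using that by (intro continuous_map_eq[OF continuous_map_const[THEN iffD2]]) auto
  have "Ck_on k n (topspace (Euclidean_space n)) f" for k
    using assms
  proof (induction k arbitrary: f c)
    case 0
    then show ?case
      using cont by simp
  next
    case (Suc k)
    have "((\<lambda>t. f (x(i := t))) has_real_derivative 0) (at (x i))"
      if "i < n" "x \<in> topspace (Euclidean_space n)" for i x
    proof -
      have "x(i := t) \<in> topspace (Euclidean_space n)" for t
        using that by (auto simp: topspace_Euclidean_space)
      then have "(\<lambda>t. f (x(i := t))) = (\<lambda>t. c)"
        using Suc.prems by blast
      then show ?thesis
        by simp
    qed
    moreover have "Ck_on k n (topspace (Euclidean_space n)) (\<lambda>u. 0)"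
      by (rule Suc.IH[of _ 0]) simp
    ultimately have "\<forall>i<n. \<exists>g. (\<forall>x\<in>topspace (Euclidean_space n).
        ((\<lambda>t. f (x(i := t))) has_real_derivative g x) (at (x i))) \<and>
        Ck_on k n (topspace (Euclidean_space n)) g"
      by (intro allI impI exI[of _ "\<lambda>u. 0"]) auto
    then show ?case
      using cont[OF Suc.prems] by simp
  qed
  then show ?thesis
    by (simp add: smooth_on_def)
qed

lemma smooth_on_imp_continuous_map:
  assumes "smooth_on n U f"
  shows "continuous_map (subtopology (Euclidean_space n) U) euclideanreal f"
  using assms Ck_on.simps(1) unfolding smooth_on_def by blast

lemma continuous_map_Phi:
  assumes "D \<subseteq> parametrisations X" and f: "f \<in> Phi X D"
  shows "continuous_map (D_topology X D) euclideanreal f"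
  unfolding continuous_map_def topspace_D_topology[OF assms(1)] openin_D_topology
proof (intro conjI allI impI)
  fix W :: "real set"
  assume W: "openin euclideanreal W"
  show "D_open X D {x \<in> X. f x \<in> W}"
    unfolding D_open_def
  proof (intro conjI ballI; clarify)
    fix n U p
    assume p: "(n, U, p) \<in> D"
    then have "openin (Euclidean_space n) U" and pU: "p \<in> U \<rightarrow>\<^sub>E X"
      using assms(1) by (auto simp: parametrisations_def)
    then have U: "U \<subseteq> topspace (Euclidean_space n)"
      by (simp add: openin_subset)
    have "smooth_on n U (f \<circ> p)"
      using f p by (auto simp: Phi_def)
    then have "openin (subtopology (Euclidean_space n) U)
        {u \<in> topspace (subtopology (Euclidean_space n) U). (f \<circ> p) u \<in> W}"
      using W openin_continuous_map_preimage smooth_on_imp_continuous_map by blast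
    moreover have "{u \<in> topspace (subtopology (Euclidean_space n) U). (f \<circ> p) u \<in> W}
        = {u \<in> U. p u \<in> {x \<in> X. f x \<in> W}}"
      using U pU by auto
    ultimately show "openin (subtopology (Euclidean_space n) U) {u \<in> U. p u \<in> {x \<in> X. f x \<in> W}}"
      by simp
  qed
qed auto

lemma not_openin_Euclidean_space_1_singleton:
  "\<not> openin (Euclidean_space 1) {\<lambda>i. 0}"
proof
  assume "openin (Euclidean_space 1) {\<lambda>i. 0 :: real}"
  moreover have "continuous_map euclideanreal (Euclidean_space 1) (\<lambda>t i. if i = 0 then t else 0)"
    by (auto simp: Euclidean_space_def continuous_map_in_subtopology
        continuous_map_componentwise_UNIV)
  ultimately have "openin euclideanreal
      {t \<in> topspace euclideanreal. (\<lambda>i::nat. if i = 0 then t else 0) \<in> {\<lambda>i. 0}}"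
    by (rule openin_continuous_map_preimage[rotated])
  moreover have "(\<lambda>i::nat. if i = 0 then t else 0) = (\<lambda>i. 0) \<longleftrightarrow> t = 0" for t :: real
    by (metis (mono_tags))
  ultimately show False
    by (simp add: not_open_singleton)
qed

text \<open>
  Reflexivity turns the map \<open>p\<close> that jumps from \<open>y\<close> to \<open>x\<close> at the origin into a plot, because no
  test function notices the jump.
\<close>
lemma D_open_closed_under_Phi_agreement:
  assumes refl: "reflexive_diffeology X D"
    and xy: "x \<in> X" "y \<in> X"
    and agree: "\<And>f. f \<in> Phi X D \<Longrightarrow> f x = f y"
    and Y: "D_open X D Y" "x \<in> Y"
  shows "y \<in> Y"
proof (rule ccontr)
  assume "y \<notin> Y"
  let ?E = "topspace (Euclidean_space 1)"
  define p where "p = (\<lambda>u \<in> ?E. if u = (\<lambda>i. 0) then x else y)"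
  have "(1, ?E, p) \<in> parametrisations X"
    using xy by (auto simp: parametrisations_def p_def)
  moreover have "smooth_on 1 ?E (f \<circ> p)" if "f \<in> Phi X D" for f
    using agree[OF that] by (intro smooth_on_constant[of _ _ "f y"]) (simp add: p_def)
  ultimately have "(1, ?E, p) \<in> D"
    using refl by (auto simp: reflexive_diffeology_def Pi_par_def)
  then have "openin (Euclidean_space 1) {u \<in> ?E. p u \<in> Y}"
    using Y(1) unfolding D_open_def by fastforce
  moreover have "{u \<in> ?E. p u \<in> Y} = {\<lambda>i. 0}"
    using \<open>x \<in> Y\<close> \<open>y \<notin> Y\<close> by (auto simp: p_def topspace_Euclidean_space)
  ultimately show False
    using not_openin_Euclidean_space_1_singleton by simp
qed

theorem proposition6p5:
  fixes X :: "'a set" and D :: "'a parametrisation set"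
  assumes "diffeological_space X D"
    and "reflexive_diffeology X D"
    and "t0_space (D_topology X D)"
  shows "Hausdorff_space (D_topology X D)"
proof -
  have D: "D \<subseteq> parametrisations X"
    using assms(1) by (rule diffeological_space.plots)
  have separated: "\<exists>f \<in> Phi X D. f x \<noteq> f y" if xy: "x \<in> X" "y \<in> X" "x \<noteq> y" for x y
  proof (rule ccontr)
    assume "\<not> ?thesis"
    then have agree: "\<And>f. f \<in> Phi X D \<Longrightarrow> f x = f y"
      by blast
    have "x \<in> Y \<longleftrightarrow> y \<in> Y" if "D_open X D Y" for Y
      using D_open_closed_under_Phi_agreement[OF assms(2)] xy agree that by metis
    then show False
      using assms(3) xy by (auto simp: t0_space_def topspace_D_topology[OF D])
  qed
  show ?thesis
    unfolding Hausdorff_space_def topspace_D_topology[OF D]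
  proof (intro allI impI)
    fix x y
    assume xy: "x \<in> X \<and> y \<in> X \<and> x \<noteq> y"
    then obtain f where f: "f \<in> Phi X D" "f x \<noteq> f y"
      using separated by blast
    obtain V W where VW: "open V" "open W" "f x \<in> V" "f y \<in> W" "V \<inter> W = {}"
      using hausdorff[OF f(2)] by blast
    have pre: "openin (D_topology X D) {z \<in> X. f z \<in> S}" if "open S" for S
      using openin_continuous_map_preimage[OF continuous_map_Phi[OF D f(1)], of S] that
      by (simp only: topspace_D_topology[OF D] open_openin)
    have "disjnt {z \<in> X. f z \<in> V} {z \<in> X. f z \<in> W}"
      using VW(5) by (auto simp: disjnt_def)
    then show "\<exists>U V. openin (D_topology X D) U \<and> openin (D_topology X D) V \<and>
        x \<in> U \<and> y \<in> V \<and> disjnt U V"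
      using pre[OF VW(1)] pre[OF VW(2)] VW(3,4) xy by blast
  qed
qed

end
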